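(* Let $r\ge3$ and $1<s\le r$ be integers, let $a_1,\dots,a_r\in\Omega$ be defined recursively by $a_1=(a_r,\mathrm{id})\sigma$, $a_i=(\mathrm{id},a_{i-1})$ for $2\le i\le s-1$, $a_s=(\mathrm{id},a_{s-1})\sigma$, $a_i=(a_{i-1},\mathrm{id})$ for $s+1\le i\le r$, and let $G$ be the closed subgroup of $\Omega$ topologically generated by $a_1,\dots,a_r$. Then $G$ contains an odometer if and only if either $r$ and $s$ are both even, or $s$ is odd and $\frac{r}{\gcd(r,s-1)}$ is even.
   Context: $T$ is the regular rooted binary tree whose vertices are finite words over $\{0,1\}$ (level $n$ = words of length $n$); $\Omega=\mathrm{Aut}(T)$ with its profinite topology; automorphisms act on the right and $\gamma\gamma'$ means first $\gamma$ then $\gamma'$. Every $\gamma\in\Omega$ is written uniquely as $(\gamma_0,\gamma_1)\tau$ with $\tau\in\{\mathrm{id},\sigma\}$, meaning $(xv)\gamma=(x)\tau\,(v)\gamma_x$ for a letter $x$ and word $v$; $\sigma=(\mathrm{id},\mathrm{id})\sigma$ swaps the first letter. Multiplication: $(\gamma_0,\gamma_1)\tau\cdot(\gamma_0',\gamma_1')\tau'=(\gamma_0\gamma'_{(0)\tau},\gamma_1\gamma'_{(1)\tau})\tau\tau'$. An odometer is an element $\gamma\in\Omega$ that acts as a single $2^n$-cycle on level $n$ for every $n\ge1$. *)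

theory Defs
  imports
    "HOL-Algebra.Generated_Groups"
    "HOL-Combinatorics.Orbits"
    "HOL-Analysis.Analysis"
begin

text \<open>
  The vertices of the binary tree are words over the letters 0, 1, encoded as \<open>False\<close>, \<open>True\<close>;
  the root is the empty word.
\<close>

type_synonym vertex = "bool list"

definition adjacent :: "vertex \<Rightarrow> vertex \<Rightarrow> bool" where
  "adjacent v w \<longleftrightarrow> (\<exists>x. w = v @ [x]) \<or> (\<exists>x. v = w @ [x])"

definition Aut_T :: "(vertex \<Rightarrow> vertex) set" where
  "Aut_T = {\<gamma>. bij \<gamma> \<and> \<gamma> [] = [] \<and> (\<forall>v w. adjacent (\<gamma> v) (\<gamma> w) \<longleftrightarrow> adjacent v w)}"

text \<open>
  Automorphisms act on the right: \<open>(w)\<gamma>\<close> is \<open>\<gamma> w\<close>, and in a product the left factor acts first.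
\<close>

definition \<Omega> :: "(vertex \<Rightarrow> vertex) monoid" where
  "\<Omega> = \<lparr>carrier = Aut_T, monoid.mult = (\<lambda>\<gamma> \<gamma>'. \<gamma>' \<circ> \<gamma>), one = id\<rparr>"

text \<open>
  The inverse limit topology of the finite groups of automorphisms of the truncated trees:
  it is generated by the fibres of the restriction maps to the levels up to \<open>n\<close>.
\<close>

definition profinite_topology :: "(vertex \<Rightarrow> vertex) topology" where
  "profinite_topology = topology_generated_by
     {{\<gamma> \<in> Aut_T. \<forall>w. length w \<le> n \<longrightarrow> \<gamma> w = \<delta> w} |n \<delta>. \<delta> \<in> Aut_T}"

definition topologically_generated :: "(vertex \<Rightarrow> vertex) set \<Rightarrow> (vertex \<Rightarrow> vertex) set" where
  "topologically_generated S = profinite_topology closure_of generate \<Omega> S"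

text \<open>
  \<open>wreath \<gamma>\<^sub>0 \<gamma>\<^sub>1 \<tau>\<close> is \<open>(\<gamma>\<^sub>0, \<gamma>\<^sub>1)\<tau>\<close>; the permutation \<open>\<tau>\<close> of the letters is \<open>id\<close> or, for \<open>\<sigma>\<close>, \<open>Not\<close>.
  The section is selected by the letter \<open>x\<close> before \<open>\<tau>\<close> is applied.
\<close>

fun wreath :: "(vertex \<Rightarrow> vertex) \<Rightarrow> (vertex \<Rightarrow> vertex) \<Rightarrow> (bool \<Rightarrow> bool) \<Rightarrow> vertex \<Rightarrow> vertex" where
  "wreath \<gamma>\<^sub>0 \<gamma>\<^sub>1 \<tau> [] = []"
| "wreath \<gamma>\<^sub>0 \<gamma>\<^sub>1 \<tau> (x # v) = \<tau> x # (if x then \<gamma>\<^sub>1 else \<gamma>\<^sub>0) v"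

definition level :: "nat \<Rightarrow> vertex set" where
  "level n = {w. length w = n}"

definition odometer :: "(vertex \<Rightarrow> vertex) \<Rightarrow> bool" where
  "odometer \<gamma> \<longleftrightarrow> \<gamma> \<in> Aut_T \<and> (\<forall>n\<ge>1. cyclic_on \<gamma> (level n))"

text \<open>
  The recursive definition of the generators \<open>a\<^sub>1, \<dots>, a\<^sub>r\<close>, which determines them uniquely
  (see \<open>recursive_generators_unique\<close> and \<open>recursive_generators_exist\<close> below).
\<close>

definition recursive_generators :: "nat \<Rightarrow> nat \<Rightarrow> (nat \<Rightarrow> vertex \<Rightarrow> vertex) \<Rightarrow> bool" where
  "recursive_generators r s a \<longleftrightarrow>
     (\<forall>i\<in>{1..r}. a i \<in> carrier \<Omega>) \<and>
     a 1 = wreath (a r) id Not \<and>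
     (\<forall>i\<in>{2..s - 1}. a i = wreath id (a (i - 1)) id) \<and>
     a s = wreath id (a (s - 1)) Not \<and>
     (\<forall>i\<in>{s + 1..r}. a i = wreath (a (i - 1)) id id)"

lemma card_level: "card (level n) = 2 ^ n"
proof -
  have "level n = {xs. set xs \<subseteq> (UNIV :: bool set) \<and> length xs = n}"
    by (auto simp: level_def)
  then show ?thesis
    using card_lists_length_eq[of "UNIV :: bool set" n] by simp
qed

lemma group_\<Omega>: "group \<Omega>"
proof (rule groupI)
  fix f assume "f \<in> carrier \<Omega>"
  then have f: "bij f" "f [] = []" "\<And>v w. adjacent (f v) (f w) \<longleftrightarrow> adjacent v w"
    by (auto simp: \<Omega>_def Aut_T_def)
  have fi: "f (inv_into UNIV f x) = x" for x
    using f(1) by (simp add: bij_is_surj surj_f_inv_f)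
  have "inv_into UNIV f \<in> Aut_T"
    unfolding Aut_T_def mem_Collect_eq
  proof (intro conjI allI)
    show "bij (inv_into UNIV f)" using f(1) by (rule bij_imp_bij_inv)
    show "inv_into UNIV f [] = []" using f by (metis bij_inv_eq_iff)
    show "adjacent (inv_into UNIV f v) (inv_into UNIV f w) \<longleftrightarrow> adjacent v w" for v w
      using f(3)[of "inv_into UNIV f v" "inv_into UNIV f w"] by (simp add: fi)
  qed
  moreover have "f \<circ> inv_into UNIV f = id" by (rule ext) (simp add: fi)
  ultimately show "\<exists>g\<in>carrier \<Omega>. g \<otimes>\<^bsub>\<Omega>\<^esub> f = \<one>\<^bsub>\<Omega>\<^esub>"
    by (auto simp: \<Omega>_def)
qed (auto simp: \<Omega>_def Aut_T_def bij_comp o_assoc)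

lemma recursive_generators_unique:
  assumes "1 < s" "s \<le> r" "recursive_generators r s a" "recursive_generators r s b" "i \<in> {1..r}"
  shows "a i = b i"
proof -
  have "a i w = b i w" if "i \<in> {1..r}" for i w
    using that
  proof (induction w arbitrary: i)
    case Nil
    then show ?case using assms(3,4) by (auto simp: recursive_generators_def \<Omega>_def Aut_T_def)
  next
    case (Cons x w)
    consider "i = 1" | "i \<in> {2..s - 1}" | "i = s" | "i \<in> {s + 1..r}"
      using Cons.prems assms(1,2) by force
    then show ?case
    proof cases
      case 1
      have "a r w = b r w" using Cons.IH[of r] assms(1,2) by auto
      then show ?thesis using 1 assms(3,4) by (simp add: recursive_generators_def)
    next
      case 2
      have "a (i - 1) w = b (i - 1) w" by (rule Cons.IH) (use 2 assms(1,2) in auto)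
      then show ?thesis using 2 assms(3,4) by (simp add: recursive_generators_def)
    next
      case 3
      have "a (i - 1) w = b (i - 1) w" by (rule Cons.IH) (use 3 assms(1,2) in auto)
      then show ?thesis using 3 assms(3,4) by (simp add: recursive_generators_def)
    next
      case 4
      have "a (i - 1) w = b (i - 1) w" by (rule Cons.IH) (use 4 assms(1,2) in auto)
      then show ?thesis using 4 assms(3,4) by (simp add: recursive_generators_def)
    qed
  qed
  then show ?thesis using assms(5) by blast
qed

lemma Aut_T_I:
  assumes inj: "inj f" and len: "\<And>w. length (f w) = length w"
    and app: "\<And>w x. \<exists>y. f (w @ [x]) = f w @ [y]"
  shows "f \<in> Aut_T"
proof -
  have surj: "\<exists>v. f v = w" for w
  proof -
    have "finite (level (length w))"
      by (rule card_ge_0_finite) (simp add: card_level)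
    moreover have "f ` level (length w) \<subseteq> level (length w)" by (auto simp: level_def len)
    ultimately have "f ` level (length w) = level (length w)"
      using inj by (intro endo_inj_surj) (auto intro: inj_on_subset)
    moreover have "w \<in> level (length w)" by (simp add: level_def)
    ultimately show ?thesis by (metis imageE)
  qed
  have child: "(\<exists>y. f w = f v @ [y]) \<longleftrightarrow> (\<exists>x. w = v @ [x])" for v w
  proof
    assume "\<exists>y. f w = f v @ [y]"
    then obtain y where y: "f w = f v @ [y]" by blast
    have "w \<noteq> []" using y len[of w] by auto
    then obtain u x where w: "w = u @ [x]" by (metis append_butlast_last_id)
    obtain z where "f w = f u @ [z]" using app w by blast
    then have "f u = f v" using y by simp
    then show "\<exists>x. w = v @ [x]" using w injD[OF inj] by blast
  qed (use app in blast)
  have "f [] = []" using len[of "[]"] by simp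
  moreover have "bij f" using inj surj by (metis bij_def surjI)
  ultimately show ?thesis by (auto simp: Aut_T_def adjacent_def child)
qed

primrec generator_word :: "nat \<Rightarrow> nat \<Rightarrow> vertex \<Rightarrow> nat \<Rightarrow> vertex" where
  "generator_word r s [] = (\<lambda>i. [])"
| "generator_word r s (x # w) = (\<lambda>i.
     (if i = 1 \<or> i = s then \<not> x else x) #
     (if i = 1 then (if x then w else generator_word r s w r)
      else if x = (i \<le> s) then generator_word r s w (i - 1) else w))"

lemma recursive_generators_exist:
  assumes "1 < s" "s \<le> r"
  shows "\<exists>a. recursive_generators r s a"
proof -
  let ?a = "\<lambda>i w. generator_word r s w i"
  have len: "length (?a i w) = length w" for i w
    by (induction w arbitrary: i) auto
  have app: "\<exists>y. ?a i (w @ [x]) = ?a i w @ [y]" for i w x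
    by (induction w arbitrary: i) auto
  have inj: "?a i v = ?a i w \<Longrightarrow> v = w" for i v w
  proof (induction v arbitrary: i w)
    case Nil
    then show ?case using len[where i = i and w = w] by simp
  next
    case (Cons x v)
    obtain y u where w: "w = y # u"
      using len[where i = i and w = w] len[where i = i and w = "x # v"] Cons.prems
      by (cases w) auto
    have "x = y" using Cons.prems w by (auto split: if_splits)
    then show ?case using Cons.prems Cons.IH w by (auto split: if_splits)
  qed
  have "?a i \<in> Aut_T" for i
    using inj by (intro Aut_T_I len app injI)
  moreover have "?a 1 = wreath (?a r) id Not"
    by (rule ext, rename_tac w, case_tac w) auto
  moreover have "?a i = wreath id (?a (i - 1)) id" if "i \<in> {2..s - 1}" for i
    using that by (intro ext, rename_tac w, case_tac w) auto
  moreover have "?a s = wreath id (?a (s - 1)) Not"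
    using assms by (intro ext, rename_tac w, case_tac w) auto
  moreover have "?a i = wreath (?a (i - 1)) id id" if "i \<in> {s + 1..r}" for i
    using that assms by (intro ext, rename_tac w, case_tac w) auto
  ultimately show ?thesis
    by (intro exI[of _ ?a]) (simp add: recursive_generators_def \<Omega>_def)
qed

end

theory Submission
  imports Defs
begin

text \<open>
  For each level \<open>n\<close>, let the sign of \<open>\<gamma>\<close> at \<open>n\<close> be \<open>-1\<close> to the number of vertices of level \<open>n\<close>
  whose two children are swapped by \<open>\<gamma>\<close>. Signs are homomorphisms, and \<open>\<gamma>\<close> is an odometer iff
  all its signs are \<open>-1\<close>: if \<open>\<gamma>\<close> is a cycle on level \<open>n\<close>, then its \<open>2\<^sup>n\<close>-th power, which fixes that
  level, swaps the children of every vertex there iff the sign at \<open>n\<close> is \<open>-1\<close>.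

  The signs of the generators are periodic in \<open>n\<close> with period \<open>r\<close>, and \<open>a\<^sub>i\<close> is odd exactly at the
  levels congruent to \<open>i - 1\<close> or to \<open>i - s\<close> modulo \<open>r\<close>. So the generators are the edges of the graph on
  \<open>\<int>/r\<close> joining \<open>k\<close> to \<open>k + (s - 1)\<close>, which is a union of \<open>d = gcd(r, s - 1)\<close> cycles of length \<open>r/d\<close>.
  The vector with all entries 1 is a sum of edges modulo 2 iff these cycles have even length: a
  perfect matching gives an odometer, and for odd length the sum over one cycle is an obstruction.
  For even \<open>s\<close> the number \<open>d\<close> is odd, so \<open>r/d\<close> is even iff \<open>r\<close> is.
\<close>

section \<open>Tree automorphisms and the levels\<close>

lemma Aut_T_Nil: "\<gamma> \<in> Aut_T \<Longrightarrow> \<gamma> [] = []"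
  by (simp add: Aut_T_def)

text \<open>The image of a child of \<open>v\<close> is adjacent to \<open>\<gamma> v\<close>, hence
  a child or the parent of it. By induction that parent is already the image of the parent of
  \<open>v\<close>, so injectivity leaves only a child.\<close>

lemma Aut_T_snoc:
  assumes "\<gamma> \<in> Aut_T"
  shows "\<exists>y. \<gamma> (v @ [x]) = \<gamma> v @ [y]"
proof (induction v arbitrary: x rule: rev_induct)
  case Nil
  have "adjacent [] [x]" by (simp add: adjacent_def)
  then have "adjacent (\<gamma> []) (\<gamma> [x])" using assms unfolding Aut_T_def by blast
  then show ?case using Aut_T_Nil[OF assms] by (auto simp: adjacent_def)
next
  case (snoc z v)
  obtain y where y: "\<gamma> (v @ [z]) = \<gamma> v @ [y]" using snoc.IH by blast
  have "inj \<gamma>" using assms by (auto simp: Aut_T_def bij_def)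
  then have "\<gamma> ((v @ [z]) @ [x]) \<noteq> \<gamma> v" by (simp add: inj_eq)
  moreover have "adjacent (v @ [z]) ((v @ [z]) @ [x])"
    by (auto simp: adjacent_def)
  then have "adjacent (\<gamma> (v @ [z])) (\<gamma> ((v @ [z]) @ [x]))"
    using assms unfolding Aut_T_def by blast
  ultimately show ?case unfolding adjacent_def y by auto
qed

lemma length_Aut_T:
  assumes "\<gamma> \<in> Aut_T"
  shows "length (\<gamma> w) = length w"
proof (induction w rule: rev_induct)
  case Nil
  then show ?case using Aut_T_Nil[OF assms] by simp
next
  case (snoc x w)
  then show ?case using Aut_T_snoc[OF assms, of w x] by auto
qed

lemma id_in_Aut_T: "id \<in> Aut_T"
  by (simp add: Aut_T_def)

lemma comp_in_Aut_T: "\<gamma> \<in> Aut_T \<Longrightarrow> \<gamma>' \<in> Aut_T \<Longrightarrow> \<gamma>' \<circ> \<gamma> \<in> Aut_T"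
  by (auto simp: Aut_T_def bij_comp)

lemma funpow_in_Aut_T: "\<gamma> \<in> Aut_T \<Longrightarrow> (\<gamma> ^^ k) \<in> Aut_T"
  by (induction k) (auto simp: id_in_Aut_T intro: comp_in_Aut_T)

lemma finite_level: "finite (level n)"
  by (rule card_ge_0_finite) (simp add: card_level)

lemma level_Suc: "level (Suc n) = Cons False ` level n \<union> Cons True ` level n"
proof -
  have "\<exists>v. length v = n \<and> (w = False # v \<or> w = True # v)" if "length w = Suc n" for w
    using that by (cases w) auto
  then show ?thesis by (fastforce simp: level_def)
qed

lemma bij_betw_level:
  assumes "\<gamma> \<in> Aut_T"
  shows "bij_betw \<gamma> (level n) (level n)"
proof -
  have inj: "inj_on \<gamma> (level n)"
    using assms by (auto simp: Aut_T_def bij_def intro: inj_on_subset)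
  moreover have "\<gamma> ` level n \<subseteq> level n"
    using length_Aut_T[OF assms] by (auto simp: level_def)
  ultimately show ?thesis
    by (simp add: bij_betw_def endo_inj_surj[OF finite_level])
qed

section \<open>Signs at the levels\<close>

definition swaps_children :: "(vertex \<Rightarrow> vertex) \<Rightarrow> vertex \<Rightarrow> bool" where
  "swaps_children \<gamma> v = last (\<gamma> (v @ [False]))"

definition vertex_sign :: "(vertex \<Rightarrow> vertex) \<Rightarrow> vertex \<Rightarrow> int" where
  "vertex_sign \<gamma> v = (if swaps_children \<gamma> v then -1 else 1)"

text \<open>For an automorphism this is the sign of its permutation of level \<open>Suc n\<close>:
  moving pairs of siblings rigidly is an even permutation, so only the swaps inside pairs
  count.\<close>

definition level_sign :: "nat \<Rightarrow> (vertex \<Rightarrow> vertex) \<Rightarrow> int" where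
  "level_sign n \<gamma> = (\<Prod>v\<in>level n. vertex_sign \<gamma> v)"

text \<open>By injectivity the two children of \<open>v\<close> have different images, so the image
  of the child \<open>False\<close> determines that of the child \<open>True\<close>.\<close>

lemma Aut_T_snoc_eq:
  assumes "\<gamma> \<in> Aut_T"
  shows "\<gamma> (v @ [x]) = \<gamma> v @ [x \<noteq> swaps_children \<gamma> v]"
proof -
  obtain y where y: "\<gamma> (v @ [False]) = \<gamma> v @ [y]" using Aut_T_snoc[OF assms] by blast
  obtain z where z: "\<gamma> (v @ [True]) = \<gamma> v @ [z]" using Aut_T_snoc[OF assms] by blast
  have "inj \<gamma>" using assms by (auto simp: Aut_T_def bij_def)
  then have "\<gamma> (v @ [False]) \<noteq> \<gamma> (v @ [True])" by (simp add: inj_eq)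
  then have "y \<noteq> z" using y z by simp
  then show ?thesis using y z by (cases x) (auto simp: swaps_children_def)
qed

lemma vertex_sign_id: "vertex_sign id v = 1"
  by (simp add: vertex_sign_def swaps_children_def)

lemma vertex_sign_comp:
  assumes "\<gamma> \<in> Aut_T" "\<gamma>' \<in> Aut_T"
  shows "vertex_sign (\<gamma>' \<circ> \<gamma>) v = vertex_sign \<gamma> v * vertex_sign \<gamma>' (\<gamma> v)"
proof -
  have "swaps_children (\<gamma>' \<circ> \<gamma>) v \<longleftrightarrow> swaps_children \<gamma> v \<noteq> swaps_children \<gamma>' (\<gamma> v)"
    using assms by (simp add: swaps_children_def[of "\<gamma>' \<circ> \<gamma>"] Aut_T_snoc_eq)
  then show ?thesis by (auto simp: vertex_sign_def)
qed

lemma vertex_sign_funpow: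
  assumes "\<gamma> \<in> Aut_T"
  shows "vertex_sign (\<gamma> ^^ k) v = (\<Prod>j<k. vertex_sign \<gamma> ((\<gamma> ^^ j) v))"
proof (induction k)
  case 0
  then show ?case by (simp add: vertex_sign_id[unfolded id_def] id_def)
next
  case (Suc k)
  then show ?case
    using vertex_sign_comp[OF funpow_in_Aut_T[OF assms] assms, of k v] by (simp add: comp_def)
qed

lemma level_sign_id: "level_sign n id = 1"
  by (simp add: level_sign_def vertex_sign_id)

lemma level_sign_comp:
  assumes "\<gamma> \<in> Aut_T" "\<gamma>' \<in> Aut_T"
  shows "level_sign n (\<gamma>' \<circ> \<gamma>) = level_sign n \<gamma> * level_sign n \<gamma>'"
proof -
  have "(\<Prod>v\<in>level n. vertex_sign \<gamma>' (\<gamma> v)) = level_sign n \<gamma>'"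
    unfolding level_sign_def by (rule prod.reindex_bij_betw[OF bij_betw_level[OF assms(1)]])
  then show ?thesis
    by (simp add: level_sign_def vertex_sign_comp[OF assms] prod.distrib)
qed

text \<open>Signs are locally constant in the profinite topology, which allows passing from the
  closure to the group itself.\<close>

lemma level_sign_cong:
  assumes "\<And>w. length w \<le> Suc n \<Longrightarrow> \<gamma> w = \<gamma>' w"
  shows "level_sign n \<gamma> = level_sign n \<gamma>'"
  unfolding level_sign_def
  by (rule prod.cong) (auto simp: vertex_sign_def swaps_children_def level_def assms)

lemma level_sign_wreath_0:
  assumes "\<gamma>\<^sub>0 \<in> Aut_T"
  shows "level_sign 0 (wreath \<gamma>\<^sub>0 \<gamma>\<^sub>1 \<tau>) = (if \<tau> False then -1 else 1)"
proof -
  have "level 0 = {[]}" by (auto simp: level_def)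
  then show ?thesis
    using length_Aut_T[OF assms, of "[False]"] Aut_T_snoc_eq[OF id_in_Aut_T]
    by (simp add: level_sign_def vertex_sign_def swaps_children_def Aut_T_Nil[OF assms])
qed

lemma level_sign_wreath_Suc:
  assumes "\<gamma>\<^sub>0 \<in> Aut_T" "\<gamma>\<^sub>1 \<in> Aut_T"
  shows "level_sign (Suc n) (wreath \<gamma>\<^sub>0 \<gamma>\<^sub>1 \<tau>) = level_sign n \<gamma>\<^sub>0 * level_sign n \<gamma>\<^sub>1"
proof -
  have vs: "vertex_sign (wreath \<gamma>\<^sub>0 \<gamma>\<^sub>1 \<tau>) (x # v) = vertex_sign (if x then \<gamma>\<^sub>1 else \<gamma>\<^sub>0) v" for x v
    using Aut_T_snoc[OF assms(1), of v False] Aut_T_snoc[OF assms(2), of v False]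
    by (auto simp add: vertex_sign_def swaps_children_def)
  have "level_sign (Suc n) (wreath \<gamma>\<^sub>0 \<gamma>\<^sub>1 \<tau>) =
      (\<Prod>v\<in>Cons False ` level n. vertex_sign (wreath \<gamma>\<^sub>0 \<gamma>\<^sub>1 \<tau>) v) *
      (\<Prod>v\<in>Cons True ` level n. vertex_sign (wreath \<gamma>\<^sub>0 \<gamma>\<^sub>1 \<tau>) v)"
    unfolding level_sign_def level_Suc
    by (rule prod.union_disjoint) (auto simp: finite_level)
  also have "\<dots> = level_sign n \<gamma>\<^sub>0 * level_sign n \<gamma>\<^sub>1"
    by (simp add: prod.reindex inj_on_def vs level_sign_def)
  finally show ?thesis .
qed

section \<open>Odometers and signs\<close>

lemma cyclic_on_bij_betw_funpow:
  assumes "cyclic_on f S" "s \<in> S"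
  shows "bij_betw (\<lambda>j. (f ^^ j) s) {..<card S} S" and "(f ^^ card S) s = s"
proof -
  have S: "S = orbit f s" and s: "s \<in> orbit f s"
    using assms by (auto simp: cyclic_on_alldef)
  let ?p = "funpow_dist1 f s s"
  have bij: "bij_betw (\<lambda>j. (f ^^ j) s) {..<?p} S"
    using inj_on_funpow_dist1[OF s] orbit_conv_funpow_dist1[OF s] S
    by (simp add: bij_betw_def atLeast0LessThan)
  then have "card S = ?p" using bij_betw_same_card by fastforce
  then show "bij_betw (\<lambda>j. (f ^^ j) s) {..<card S} S" "(f ^^ card S) s = s"
    using bij funpow_dist1_prop[OF s] by simp_all
qed

lemma cyclic_on_level_Suc_iff:
  assumes \<gamma>: "\<gamma> \<in> Aut_T" and cyc: "cyclic_on \<gamma> (level n)"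
  shows "cyclic_on \<gamma> (level (Suc n)) \<longleftrightarrow> level_sign n \<gamma> = -1"
proof -
  let ?N = "2 ^ n :: nat"
  have return: "(\<gamma> ^^ ?N) (v @ [x]) = v @ [x \<noteq> (level_sign n \<gamma> = -1)]" if "v \<in> level n" for v x
  proof -
    note bij = cyclic_on_bij_betw_funpow[OF cyc that, unfolded card_level]
    \<comment> \<open>In \<open>?N\<close> steps the cycle visits every vertex of level
      \<open>n\<close> once, so the product of signs along the orbit is the product over the
      level.\<close>
    have "vertex_sign (\<gamma> ^^ ?N) v = level_sign n \<gamma>"
      unfolding vertex_sign_funpow[OF \<gamma>] level_sign_def
      by (rule prod.reindex_bij_betw[OF bij(1)])
    then have "swaps_children (\<gamma> ^^ ?N) v \<longleftrightarrow> level_sign n \<gamma> = -1"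
      by (auto simp: vertex_sign_def split: if_splits)
    then show ?thesis
      using Aut_T_snoc_eq[OF funpow_in_Aut_T[OF \<gamma>], of ?N v x] bij(2) by simp
  qed
  define v where "v = replicate n False"
  have v: "v \<in> level n" "v @ [False] \<in> level (Suc n)" by (simp_all add: v_def level_def)
  show ?thesis
  proof
    assume "cyclic_on \<gamma> (level (Suc n))"
    from cyclic_on_bij_betw_funpow(1)[OF this v(2)]
    have "inj_on (\<lambda>j. (\<gamma> ^^ j) (v @ [False])) {..<2 ^ Suc n}"
      by (simp add: bij_betw_def card_level)
    from inj_onD[OF this, of ?N 0] have "(\<gamma> ^^ ?N) (v @ [False]) \<noteq> v @ [False]" by auto
    then show "level_sign n \<gamma> = -1" using return[OF v(1), of False] by auto
  next
    assume "level_sign n \<gamma> = -1"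
    then have flip: "(\<gamma> ^^ ?N) (w @ [x]) = w @ [\<not> x]" if "w \<in> level n" for w x
      using return[OF that] by simp
    have "level (Suc n) = orbit \<gamma> (v @ [False])"
    proof
      show "orbit \<gamma> (v @ [False]) \<subseteq> level (Suc n)"
        using v(2) length_Aut_T[OF funpow_in_Aut_T[OF \<gamma>]] by (auto simp: orbit_altdef level_def)
      show "level (Suc n) \<subseteq> orbit \<gamma> (v @ [False])"
      proof
        fix u assume "u \<in> level (Suc n)"
        then obtain w y where u: "u = w @ [y]" and w: "w \<in> level n"
          by (cases u rule: rev_cases) (auto simp: level_def)
        have "w \<in> orbit \<gamma> v" using cyc v(1) w by (auto simp: cyclic_on_alldef)
        then obtain k where k: "0 < k" "w = (\<gamma> ^^ k) v" by (auto simp: orbit_altdef)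
        obtain z where z: "(\<gamma> ^^ k) (v @ [False]) = w @ [z]"
          using Aut_T_snoc[OF funpow_in_Aut_T[OF \<gamma>]] k(2) by blast
        \<comment> \<open>\<open>k\<close> steps reach the right parent \<open>w\<close>. If they
          end at the wrong child, one more turn of \<open>?N\<close> steps returns to
          \<open>w\<close> with the last letter flipped.\<close>
        define m where "m = (if y = z then k else ?N + k)"
        have "u = (\<gamma> ^^ m) (v @ [False])"
          by (auto simp: u m_def funpow_add z flip[OF w])
        moreover have "0 < m" using k(1) by (simp add: m_def)
        ultimately show "u \<in> orbit \<gamma> (v @ [False])" unfolding orbit_altdef by blast
      qed
    qed
    then show "cyclic_on \<gamma> (level (Suc n))" using v(2) by (auto simp: cyclic_on_def)
  qed
qed

lemma odometer_iff_level_sign: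
  assumes \<gamma>: "\<gamma> \<in> Aut_T"
  shows "odometer \<gamma> \<longleftrightarrow> (\<forall>n. level_sign n \<gamma> = -1)"
proof -
  \<comment> \<open>Odometers are defined from level 1 on; the root level starts the induction, and
    the sign at 0 decides level 1.\<close>
  have "orbit \<gamma> [] = {[]}" using Aut_T_Nil[OF \<gamma>] by (simp add: orbit_eq_singleton_iff)
  moreover have "level 0 = {[]}" by (auto simp: level_def)
  ultimately have cyc0: "cyclic_on \<gamma> (level 0)" by (simp add: cyclic_on_def)
  show ?thesis
  proof
    assume "odometer \<gamma>"
    then have "cyclic_on \<gamma> (level n)" for n
      using cyc0 by (cases n) (auto simp: odometer_def)
    then show "\<forall>n. level_sign n \<gamma> = -1" using cyclic_on_level_Suc_iff[OF \<gamma>] by blast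
  next
    assume sign: "\<forall>n. level_sign n \<gamma> = -1"
    have "cyclic_on \<gamma> (level n)" for n
      by (induction n) (use cyc0 sign cyclic_on_level_Suc_iff[OF \<gamma>] in auto)
    then show "odometer \<gamma>" using \<gamma> by (simp add: odometer_def)
  qed
qed

section \<open>Signs on the generated group and its closure\<close>

lemma carrier_\<Omega>: "carrier \<Omega> = Aut_T" and mult_\<Omega>: "\<gamma> \<otimes>\<^bsub>\<Omega>\<^esub> \<gamma>' = \<gamma>' \<circ> \<gamma>" and one_\<Omega>: "\<one>\<^bsub>\<Omega>\<^esub> = id"
  by (simp_all add: \<Omega>_def)

lemma level_sign_mult:
  assumes "\<gamma> \<in> carrier \<Omega>" "\<gamma>' \<in> carrier \<Omega>"
  shows "level_sign n (\<gamma> \<otimes>\<^bsub>\<Omega>\<^esub> \<gamma>') = level_sign n \<gamma> * level_sign n \<gamma>'"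
  using assms by (simp add: carrier_\<Omega> mult_\<Omega> level_sign_comp)

lemma prod_level_sign_generate_eq_1:
  assumes "S \<subseteq> carrier \<Omega>" "\<And>\<delta>. \<delta> \<in> S \<Longrightarrow> (\<Prod>n\<in>D. level_sign n \<delta>) = 1" "\<gamma> \<in> generate \<Omega> S"
  shows "(\<Prod>n\<in>D. level_sign n \<gamma>) = 1"
  using assms(3)
proof (induction rule: generate.induct)
  case one
  show ?case by (simp only: one_\<Omega> level_sign_id prod.neutral_const)
next
  case (incl h)
  then show ?case by (rule assms(2))
next
  case (inv h)
  then have h: "h \<in> carrier \<Omega>" using assms(1) by auto
  have "level_sign n h * level_sign n (inv\<^bsub>\<Omega>\<^esub> h) = 1" for n
    using level_sign_mult[OF h group.inv_closed[OF group_\<Omega> h], of n]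
    by (simp add: group.r_inv[OF group_\<Omega> h] one_\<Omega> level_sign_id)
  then have "(\<Prod>n\<in>D. level_sign n h) * (\<Prod>n\<in>D. level_sign n (inv\<^bsub>\<Omega>\<^esub> h)) = 1"
    by (simp add: prod.distrib[symmetric])
  then show ?case using assms(2)[OF inv] by simp
next
  case (eng h1 h2)
  then have "h1 \<in> carrier \<Omega>" "h2 \<in> carrier \<Omega>"
    using group.generate_in_carrier[OF group_\<Omega> assms(1)] by auto
  then show ?case using eng.IH by (simp add: level_sign_mult prod.distrib)
qed

text \<open>The witness is the product of the \<open>a i\<close> over \<open>I\<close> in any order,
  since signs take values in a commutative group.\<close>

lemma generate_prod_level_sign:
  assumes "a ` J \<subseteq> carrier \<Omega>" "finite I" "I \<subseteq> J"
  shows "\<exists>\<gamma> \<in> generate \<Omega> (a ` J). \<forall>n. level_sign n \<gamma> = (\<Prod>i\<in>I. level_sign n (a i))"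
  using assms(2,3)
proof (induction I rule: finite_induct)
  case empty
  show ?case by (rule bexI[OF _ generate.one]) (simp only: one_\<Omega> level_sign_id prod.empty simp_thms)
next
  case (insert i I)
  then obtain \<gamma> where \<gamma>: "\<gamma> \<in> generate \<Omega> (a ` J)"
      "\<And>n. level_sign n \<gamma> = (\<Prod>i\<in>I. level_sign n (a i))"
    by auto
  have i: "a i \<in> generate \<Omega> (a ` J)" using insert.prems by (auto intro: generate.incl)
  have "a i \<in> carrier \<Omega>" "\<gamma> \<in> carrier \<Omega>"
    using i \<gamma>(1) group.generate_in_carrier[OF group_\<Omega> assms(1)] by auto
  then have "level_sign n (a i \<otimes>\<^bsub>\<Omega>\<^esub> \<gamma>) = (\<Prod>i\<in>insert i I. level_sign n (a i))" for n
    using insert.hyps \<gamma>(2) by (simp add: level_sign_mult)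
  then show ?case using generate.eng[OF i \<gamma>(1)] by blast
qed

lemma topspace_profinite_topology: "topspace profinite_topology = Aut_T"
  unfolding profinite_topology_def topology_generated_by_topspace by auto

lemma generate_subset_topologically_generated:
  assumes "S \<subseteq> carrier \<Omega>"
  shows "generate \<Omega> S \<subseteq> topologically_generated S"
  unfolding topologically_generated_def
  using group.generate_in_carrier[OF group_\<Omega> assms]
  by (intro closure_of_subset) (auto simp: topspace_profinite_topology carrier_\<Omega>)

text \<open>The automorphisms agreeing with \<open>\<gamma>\<close> up to level \<open>n\<close>
  form an open neighbourhood of \<open>\<gamma>\<close>, which must meet the generated
  group.\<close>

lemma topologically_generated_approx:
  assumes "\<gamma> \<in> topologically_generated S"
  shows "\<gamma> \<in> Aut_T" and "\<exists>\<delta> \<in> generate \<Omega> S. \<forall>w. length w \<le> n \<longrightarrow> \<delta> w = \<gamma> w"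
proof -
  have \<gamma>: "\<gamma> \<in> profinite_topology closure_of generate \<Omega> S"
    using assms by (simp add: topologically_generated_def)
  then show Aut: "\<gamma> \<in> Aut_T"
    using closure_of_subset_topspace by (force simp: topspace_profinite_topology)
  let ?U = "{\<delta> \<in> Aut_T. \<forall>w. length w \<le> n \<longrightarrow> \<delta> w = \<gamma> w}"
  have "openin profinite_topology ?U"
    unfolding profinite_topology_def by (rule topology_generated_by_Basis) (use Aut in blast)
  moreover have "\<gamma> \<in> ?U" using Aut by simp
  ultimately have "\<exists>\<delta>. \<delta> \<in> generate \<Omega> S \<and> \<delta> \<in> ?U"
    using \<gamma>[unfolded in_closure_of, THEN conjunct2, THEN spec, of ?U] by simp
  then show "\<exists>\<delta> \<in> generate \<Omega> S. \<forall>w. length w \<le> n \<longrightarrow> \<delta> w = \<gamma> w" by blast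
qed

section \<open>Signs of the recursive generators\<close>

lemma recursive_generators_cases:
  assumes "1 < s" "s \<le> r" "recursive_generators r s a" "i \<in> {1..r}"
  obtains j \<tau> where "j = (if i = 1 then r else i - 1)" "j \<in> {1..r}" "a j \<in> Aut_T"
    "a i = wreath (a j) id \<tau> \<or> a i = wreath id (a j) \<tau>" "\<tau> False \<longleftrightarrow> i = 1 \<or> i = s"
proof -
  define j where "j = (if i = 1 then r else i - 1)"
  have j: "j \<in> {1..r}" using assms by (auto simp: j_def)
  then have Aut: "a j \<in> Aut_T" using assms(3) by (simp add: recursive_generators_def \<Omega>_def)
  have rec: "a 1 = wreath (a r) id Not" "\<And>i. i \<in> {2..s - 1} \<Longrightarrow> a i = wreath id (a (i - 1)) id"
      "a s = wreath id (a (s - 1)) Not" "\<And>i. i \<in> {s + 1..r} \<Longrightarrow> a i = wreath (a (i - 1)) id id"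
    using assms(3) unfolding recursive_generators_def by blast+
  consider "i = 1" | "i \<in> {2..s - 1}" | "i = s" | "i \<in> {s + 1..r}"
    using assms by force
  then show ?thesis
  proof cases
    case 1
    then show ?thesis using that[OF j_def j Aut, of Not] rec(1) by (simp add: j_def)
  next
    case 2
    then have "i \<noteq> 1" "i \<noteq> s" by auto
    then show ?thesis using that[OF j_def j Aut, of id] rec(2)[OF 2] by (simp add: j_def)
  next
    case 3
    then show ?thesis using that[OF j_def j Aut, of Not] rec(3) assms(1) by (simp add: j_def)
  next
    case 4
    then have "i \<noteq> 1" "i \<noteq> s" using assms(1) by auto
    then show ?thesis using that[OF j_def j Aut, of id] rec(4)[OF 4] by (simp add: j_def)
  qed
qed

text \<open>At level 0 exactly \<open>a 1\<close> and \<open>a s\<close> are odd. One level deeper,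
  \<open>a i\<close> inherits the sign of its only nontrivial section, its cyclic predecessor, so
  the two odd indices advance by one modulo \<open>r\<close>. \<open>Suc\<close> turns residues into
  indices in \<open>{1..r}\<close>.\<close>

lemma level_sign_recursive_generators:
  assumes "1 < s" "s \<le> r" "recursive_generators r s a" "i \<in> {1..r}"
  shows "level_sign n (a i) =
    (if i = Suc (n mod r) then -1 else 1) * (if i = Suc ((n + (s - 1)) mod r) then -1 else 1)"
  using assms(4)
proof (induction n arbitrary: i)
  case 0
  obtain j \<tau> where "a j \<in> Aut_T" "a i = wreath (a j) id \<tau> \<or> a i = wreath id (a j) \<tau>"
      "\<tau> False \<longleftrightarrow> i = 1 \<or> i = s"
    using recursive_generators_cases[OF assms(1-3) 0] .
  then have "level_sign 0 (a i) = (if i = 1 \<or> i = s then -1 else 1)"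
    using id_in_Aut_T by (auto simp: level_sign_wreath_0)
  then show ?case using assms(1,2) by auto
next
  case (Suc n)
  obtain j \<tau> where j: "j = (if i = 1 then r else i - 1)" "j \<in> {1..r}" "a j \<in> Aut_T"
      and \<tau>: "a i = wreath (a j) id \<tau> \<or> a i = wreath id (a j) \<tau>"
    using recursive_generators_cases[OF assms(1-3) Suc.prems] .
  then have "level_sign (Suc n) (a i) = level_sign n (a j)"
    using id_in_Aut_T by (auto simp: level_sign_wreath_Suc level_sign_id)
  moreover have "i = Suc (Suc m mod r) \<longleftrightarrow> j = Suc (m mod r)" for m
    using Suc.prems mod_less_divisor[of r m] assms(1,2) by (auto simp: j(1) mod_Suc)
  ultimately show ?case using Suc.IH[OF j(2)] by simp
qed

text \<open>Cut the naturals into blocks of length \<open>d\<close>. Reduction modulo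
  \<open>r\<close> removes a multiple of \<open>r div d\<close> blocks, an even number, so block
  parity is well defined on residues modulo \<open>r\<close>.\<close>

lemma even_mod_div:
  fixes d r x :: nat
  assumes "d dvd r" "even (r div d)"
  shows "even ((x mod r) div d) \<longleftrightarrow> even (x div d)"
proof (cases "r = 0")
  case False
  have "x div d = (r * (x div r) + x mod r) div d" by simp
  also have "\<dots> = (d * ((r div d) * (x div r)) + x mod r) div d"
    using assms(1) by (metis dvd_mult_div_cancel mult.assoc)
  also have "\<dots> = (r div d) * (x div r) + (x mod r) div d"
    using False assms(1) by (subst div_mult_self4) auto
  finally show ?thesis using assms(2) by simp
qed simp

section \<open>Cycles of the graph on \<open>\<int>/r\<close>: obstruction and matching\<close>

theorem theorem5p3:
  fixes r s :: nat and a :: "nat \<Rightarrow> vertex \<Rightarrow> vertex"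
  assumes "r \<ge> 3" and "1 < s" and "s \<le> r"
    and "recursive_generators r s a"
  shows "(\<exists>\<gamma> \<in> topologically_generated (a ` {1..r}). odometer \<gamma>) \<longleftrightarrow>
         (even r \<and> even s) \<or> (odd s \<and> even (r div gcd r (s - 1)))"
proof -
  define d where "d = gcd r (s - 1)"
  have d: "d dvd r" "d dvd s - 1" "0 < d" using assms by (auto simp: d_def)
  have parity: "even (r div d) \<longleftrightarrow> (even r \<and> even s) \<or> (odd s \<and> even (r div d))"
  proof (cases "even s")
    case True
    then have "odd (s - 1)" using assms(2) by simp
    then have "odd d" using d(2) dvd_trans by blast
    moreover have "r = d * (r div d)" using d(1) by simp
    ultimately have "even r \<longleftrightarrow> even (r div d)" by (metis even_mult_iff)
    then show ?thesis using True by simp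
  qed simp
  let ?S = "a ` {1..r}"
  have S: "?S \<subseteq> carrier \<Omega>" using assms(4) by (auto simp: recursive_generators_def)
  note sign = level_sign_recursive_generators[OF assms(2-4)]
  have "(\<exists>\<gamma> \<in> topologically_generated ?S. odometer \<gamma>) \<longleftrightarrow> even (r div d)"
  proof
    assume "\<exists>\<gamma> \<in> topologically_generated ?S. odometer \<gamma>"
    then obtain \<gamma> where \<gamma>: "\<gamma> \<in> topologically_generated ?S" "odometer \<gamma>" by blast
    \<comment> \<open>Agreement up to level \<open>r\<close> suffices: the signs at
      \<open>n < r\<close> depend on levels up to \<open>Suc n\<close>.\<close>
    obtain \<delta> where \<delta>: "\<delta> \<in> generate \<Omega> ?S" "\<And>w. length w \<le> r \<Longrightarrow> \<delta> w = \<gamma> w"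
      using topologically_generated_approx(2)[OF \<gamma>(1)] by blast
    \<comment> \<open>The vertices of the cycle through 0. Each edge has both ends or neither in it,
      so every generator has an even number of odd signs there.\<close>
    let ?D = "{n. n < r \<and> d dvd n}"
    have "(\<Prod>n\<in>?D. level_sign n (a i)) = 1" if i: "i \<in> {1..r}" for i
    proof -
      \<comment> \<open>The residue of \<open>i - s\<close> modulo \<open>r\<close>, written so that
        subtraction on naturals never truncates; \<open>i - 1\<close> and \<open>k\<close> are the
        ends of the edge \<open>a i\<close>.\<close>
      define k where "k = (if s \<le> i then i - s else i + r - s)"
      have "k < r" using i assms(2,3) by (auto simp: k_def)
      have "k + (s - 1) = (if s \<le> i then i - 1 else i - 1 + r)"
        using i assms(2,3) by (auto simp: k_def)
      then have "d dvd k \<longleftrightarrow> d dvd i - 1"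
        using dvd_add_left_iff[OF d(2), of k] dvd_add_left_iff[OF d(1), of "i - 1"]
        by (auto split: if_splits)
      have "i = Suc (n mod r) \<longleftrightarrow> n = i - 1" if "n < r" for n
        using that i by auto
      moreover have "i = Suc ((n + (s - 1)) mod r) \<longleftrightarrow> n = k" if "n < r" for n
        using that i assms(2,3) by (auto simp: k_def mod_if)
      ultimately have "(\<Prod>n\<in>?D. level_sign n (a i)) =
          (\<Prod>n\<in>?D. if n = i - 1 then -1 else 1) * (\<Prod>n\<in>?D. if n = k then -1 else 1)"
        by (simp add: sign[OF i] prod.distrib)
      also have "\<dots> = 1" using \<open>k < r\<close> \<open>d dvd k \<longleftrightarrow> d dvd i - 1\<close> i by (auto simp: prod.delta)
      finally show ?thesis .
    qed
    then have "(\<Prod>n\<in>?D. level_sign n \<delta>) = 1"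
      by (intro prod_level_sign_generate_eq_1[OF S _ \<delta>(1)]) auto
    moreover have "level_sign n \<delta> = -1" if "n \<in> ?D" for n
      using that \<gamma> \<delta>(2) odometer_iff_level_sign[OF topologically_generated_approx(1)[OF \<gamma>(1)]]
        level_sign_cong[of n \<delta> \<gamma>] by auto
    \<comment> \<open>The product over \<open>?D\<close> is both 1 and
      \<open>(-1) ^ card ?D\<close>.\<close>
    ultimately have "even (card ?D)" by (simp add: uminus_power_if split: if_splits)
    moreover have "bij_betw ((*) d) {..<r div d} ?D"
      using d by (auto simp: bij_betw_def inj_on_def image_iff elim!: dvdE)
    then have "card ?D = r div d" using bij_betw_same_card by fastforce
    ultimately show "even (r div d)" by simp
  next
    assume even: "even (r div d)"
    \<comment> \<open>a perfect matching of every cycle: since \<open>(s - 1)/d\<close> is odd, the two ends \<open>k\<close> of an edge have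
      values \<open>k div d\<close> of different parity\<close>
    let ?I = "{i \<in> {1..r}. even ((i - 1) div d)}"
    obtain \<gamma> where \<gamma>: "\<gamma> \<in> generate \<Omega> ?S" "\<And>n. level_sign n \<gamma> = (\<Prod>i\<in>?I. level_sign n (a i))"
      using generate_prod_level_sign[OF S, of ?I] by (auto simp del: atLeastAtMost_iff)
    \<comment> \<open>A number coprime to the even number \<open>r div d\<close> is odd.\<close>
    have "coprime (r div d) ((s - 1) div d)"
      using assms(1) unfolding d_def by (intro div_gcd_coprime) auto
    then have "odd ((s - 1) div d)" using even coprime_common_divisor odd_one by blast
    moreover have "(n + (s - 1)) div d = n div d + (s - 1) div d" for n
      using d(2) by (rule div_plus_div_distrib_dvd_right)
    ultimately have shift: "even ((n + (s - 1)) div d) \<longleftrightarrow> odd (n div d)" for n by simp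
    have "level_sign n \<gamma> = -1" for n
    proof -
      have "level_sign n \<gamma> = (\<Prod>i\<in>?I. if i = Suc (n mod r) then -1 else 1) *
          (\<Prod>i\<in>?I. if i = Suc ((n + (s - 1)) mod r) then -1 else 1)"
        unfolding \<gamma>(2) prod.distrib[symmetric] by (rule prod.cong) (auto simp: sign)
      \<comment> \<open>Two generators are odd at level \<open>n\<close>; their indices minus one
        are \<open>n\<close> and \<open>n + (s - 1)\<close> modulo \<open>r\<close>. By
        \<open>shift\<close> these lie in blocks of opposite parity, so exactly one index is in
        \<open>?I\<close> and one factor is -1.\<close>
      also have "\<dots> = -1"
        using assms(1) shift[of n] even_mod_div[OF d(1) even, of n]
          even_mod_div[OF d(1) even, of "n + (s - 1)"]
        by (auto simp: prod.delta Suc_le_eq)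
      finally show ?thesis .
    qed
    moreover have "\<gamma> \<in> topologically_generated ?S"
      using \<gamma>(1) generate_subset_topologically_generated[OF S] by blast
    ultimately show "\<exists>\<gamma> \<in> topologically_generated ?S. odometer \<gamma>"
      using odometer_iff_level_sign topologically_generated_approx(1) by blast
  qed
  then show ?thesis using parity by (simp add: d_def)
qed

end
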